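(* Let $m\ge 2$ be an integer, let $\alpha_2,\ldots,\alpha_m\in\mathbb{R}$, and define $$E:=\{(x_1,\ldots,x_m)\in\mathbb{R}^m : x_i-x_1\geq\alpha_i \text{ for all } i\in\{2,\ldots,m\}\}.$$ Let $z=(z_1,\ldots,z_m)\in\mathbb{R}^m$. Let $\delta_1:=z_1$ and let $\delta_2\leq\delta_3\leq\cdots\leq\delta_m$ be the values $\{z_i-\alpha_i\}_{i\in\{2,\ldots,m\}}$ (listed with multiplicity) in nondecreasing order. Let $k$ be the largest number in $\{1,\ldots,m\}$ such that $$\delta_k\leq\frac{\delta_1+\cdots+\delta_k}{k}.$$ Then the projection $x=(x_1,x_2,\ldots,x_m):=P_E z$ is given by $$x_1=\frac{\delta_1+\cdots+\delta_k}{k}\quad\text{and}\quad x_i=\max\{x_1,\,z_i-\alpha_i\}+\alpha_i\quad\text{for all } i\in\{2,\ldots,m\}.$$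
   Context: $\mathbb{R}^m$ carries the standard inner product and the induced Euclidean norm $\|\cdot\|$. For a nonempty closed convex set $C\subseteq\mathbb{R}^m$, $P_C z$ denotes the unique point of $C$ minimizing $\|z-x\|$ over $x\in C$. Note that $\delta_1=z_1$ is not part of the sorting: only $\delta_2,\ldots,\delta_m$ are sorted. *)

theory Defs
  imports "HOL-Analysis.Analysis"
begin

text \<open>
  Euclidean space of dimension \<open>m\<close> is \<open>real ^ 'n\<close>, whose coordinates are numbered by an
  enumeration \<open>\<iota>\<close> of the index type, i.e. a bijection from \<open>{1..m}\<close> onto \<open>UNIV :: 'n set\<close>
  (so that \<open>m = CARD('n)\<close>); the \<open>i\<close>-th coordinate of \<open>x\<close> is \<open>x $ \<iota> i\<close>.
\<close>

definition lower_gap_set :: "(nat \<Rightarrow> 'n::finite) \<Rightarrow> nat \<Rightarrow> (nat \<Rightarrow> real) \<Rightarrow> (real ^ 'n) set" where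
  "lower_gap_set \<iota> m \<alpha> = {x. \<forall>i\<in>{2..m}. x $ \<iota> i - x $ \<iota> 1 \<ge> \<alpha> i}"

text \<open>
  The set is nonempty, closed and convex, so \<^const>\<open>closest_point\<close> is the
  projection onto it, i.e. its value is the unique minimizer of the distance.
\<close>

lemma closed_lower_gap_set: "closed (lower_gap_set \<iota> m \<alpha>)"
proof -
  have "lower_gap_set \<iota> m \<alpha> = (\<Inter>i\<in>{2..m}. {x. \<alpha> i \<le> x $ \<iota> i - x $ \<iota> 1})"
    by (auto simp: lower_gap_set_def)
  then show ?thesis
    by (auto intro!: closed_INT closed_Collect_le continuous_intros)
qed

lemma convex_lower_gap_set: "convex (lower_gap_set \<iota> m \<alpha>)"
  unfolding convex_alt lower_gap_set_def
proof (intro ballI allI impI CollectI)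
  fix x y :: "real ^ 'a" and u :: real and i
  assume x: "x \<in> {x. \<forall>i\<in>{2..m}. x $ \<iota> i - x $ \<iota> 1 \<ge> \<alpha> i}"
    and y: "y \<in> {x. \<forall>i\<in>{2..m}. x $ \<iota> i - x $ \<iota> 1 \<ge> \<alpha> i}"
    and u: "0 \<le> u \<and> u \<le> 1" and i: "i \<in> {2..m}"
  have "(1 - u) * \<alpha> i + u * \<alpha> i \<le> (1 - u) * (x $ \<iota> i - x $ \<iota> 1) + u * (y $ \<iota> i - y $ \<iota> 1)"
    using x y u i by (intro add_mono mult_left_mono) auto
  then show "\<alpha> i \<le> ((1 - u) *\<^sub>R x + u *\<^sub>R y) $ \<iota> i - ((1 - u) *\<^sub>R x + u *\<^sub>R y) $ \<iota> 1"
    by (simp add: algebra_simps)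
qed

lemma lower_gap_set_nonempty:
  assumes "bij_betw \<iota> {1..m} (UNIV :: 'n::finite set)"
  shows "lower_gap_set \<iota> m \<alpha> \<noteq> {}"
proof -
  define x :: "real ^ 'n" where
    "x = (\<chi> j. if j = \<iota> 1 then 0 else \<alpha> (inv_into {1..m} \<iota> j))"
  have "\<alpha> i \<le> x $ \<iota> i - x $ \<iota> 1" if "i \<in> {2..m}" for i
  proof -
    have inj: "inj_on \<iota> {1..m}"
      using assms by (rule bij_betw_imp_inj_on)
    have "\<iota> i \<noteq> \<iota> 1"
      using that inj_onD[OF inj, of i 1] by auto
    moreover have "inv_into {1..m} \<iota> (\<iota> i) = i"
      using that inj by (intro inv_into_f_f) auto
    ultimately show ?thesis
      by (simp add: x_def)
  qed
  then have "x \<in> lower_gap_set \<iota> m \<alpha>"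
    by (simp add: lower_gap_set_def)
  then show ?thesis
    by blast
qed

lemma closest_point_lower_gap_set_iff:
  assumes "bij_betw \<iota> {1..m} (UNIV :: 'n::finite set)"
  shows "x = closest_point (lower_gap_set \<iota> m \<alpha>) z \<longleftrightarrow>
    x \<in> lower_gap_set \<iota> m \<alpha> \<and> (\<forall>y\<in>lower_gap_set \<iota> m \<alpha>. norm (z - x) \<le> norm (z - y))"
  using closest_point_exists[OF closed_lower_gap_set lower_gap_set_nonempty[OF assms], of \<alpha> z]
    closest_point_unique[OF convex_lower_gap_set closed_lower_gap_set, of x \<iota> m \<alpha> z]
  by (auto simp: dist_norm)

end

theory Submission
  imports Defs
begin

text \<open>
  Once the first coordinate \<open>t\<close> of a point of the set is fixed, the best choice for every other
  coordinate is \<open>max t (z\<^sub>i - \<alpha>\<^sub>i) + \<alpha>\<^sub>i\<close>. The point \<open>y\<close> obtained in this way is the projection of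
  \<open>z\<close> as soon as \<open>t\<close> satisfies the stationarity equation
  \<open>(z\<^sub>1 - t) + (\<Sum>i\<ge>2. min (z\<^sub>i - \<alpha>\<^sub>i - t) 0) = 0\<close>: for \<open>w\<close> in the set, each summand of
  \<open>(z - y) \<bullet> (w - y)\<close> with index \<open>i \<ge> 2\<close> is at most \<open>min (z\<^sub>i - \<alpha>\<^sub>i - t) 0 * (w\<^sub>1 - t)\<close>, so the
  inner product is at most \<open>w\<^sub>1 - t\<close> times the left-hand side of the equation, which is zero
  (\<open>closest_point_lower_gap_set_coords\<close>).

  The equation depends only on the multiset of the values \<open>z\<^sub>i - \<alpha>\<^sub>i\<close>, so these may be replaced by
  \<open>\<delta>\<^sub>2 \<le> \<dots> \<le> \<delta>\<^sub>m\<close>. If \<open>t\<close> is the mean of \<open>\<delta>\<^sub>1, \<dots>, \<delta>\<^sub>k\<close>, the choice of \<open>k\<close> gives \<open>\<delta>\<^sub>i \<le> t\<close> for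
  \<open>2 \<le> i \<le> k\<close> and, by maximality, \<open>\<delta>\<^sub>i \<ge> t\<close> for \<open>i > k\<close>; the equation then reads
  \<open>(\<Sum>i\<le>k. \<delta>\<^sub>i - t) = 0\<close> (\<open>sum_min_mean_eq_0\<close>).
\<close>

lemma closest_point_lower_gap_set_coords:
  fixes \<iota> :: "nat \<Rightarrow> 'n::finite" and z :: "real ^ 'n"
  assumes m: "m \<ge> 1"
    and bij: "bij_betw \<iota> {1..m} (UNIV :: 'n set)"
    and stationary: "(z $ \<iota> 1 - t) + (\<Sum>i = 2..m. min (z $ \<iota> i - \<alpha> i - t) 0) = 0"
  shows "closest_point (lower_gap_set \<iota> m \<alpha>) z $ \<iota> 1 = t"
    and "i \<in> {2..m} \<Longrightarrow>
      closest_point (lower_gap_set \<iota> m \<alpha>) z $ \<iota> i = max t (z $ \<iota> i - \<alpha> i) + \<alpha> i"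
proof -
  define c where "c i = (if i = 1 then t else max t (z $ \<iota> i - \<alpha> i) + \<alpha> i)" for i
  define y :: "real ^ 'n" where "y = (\<chi> j. c (inv_into {1..m} \<iota> j))"
  have inj: "inj_on \<iota> {1..m}"
    using bij by (rule bij_betw_imp_inj_on)
  have y_nth: "y $ \<iota> i = c i" if "i \<in> {1..m}" for i
    using that unfolding y_def vec_lambda_beta by (subst inv_into_f_f[OF inj]) simp_all
  have y1: "y $ \<iota> 1 = t"
    using y_nth[of 1] m by (simp add: c_def)
  have yi: "y $ \<iota> i = max t (z $ \<iota> i - \<alpha> i) + \<alpha> i" if "i \<in> {2..m}" for i
    using y_nth[of i] that by (simp add: c_def)
  have y_mem: "y \<in> lower_gap_set \<iota> m \<alpha>"
    using y1 yi by (auto simp: lower_gap_set_def)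
  have "norm (z - y) \<le> norm (z - w)" if w: "w \<in> lower_gap_set \<iota> m \<alpha>" for w
  proof -
    have term_le: "(z - y) $ \<iota> i * (w - y) $ \<iota> i \<le> min (z $ \<iota> i - \<alpha> i - t) 0 * (w $ \<iota> 1 - t)"
      if i: "i \<in> {2..m}" for i
    proof (cases "z $ \<iota> i - \<alpha> i \<le> t")
      case True
      have "w $ \<iota> 1 - t \<le> (w - y) $ \<iota> i"
        using bspec[OF w[unfolded lower_gap_set_def mem_Collect_eq] i] yi[OF i] True by simp
      moreover have "(z - y) $ \<iota> i = min (z $ \<iota> i - \<alpha> i - t) 0"
        using yi[OF i] True by (simp add: max_def min_def)
      moreover have "min (z $ \<iota> i - \<alpha> i - t) 0 \<le> 0"
        by simp
      ultimately show ?thesis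
        by (simp only: mult_left_mono_neg)
    next
      case False
      then show ?thesis
        using yi[OF i] by (simp add: max_def min_def)
    qed
    have "(z - y) \<bullet> (w - y) = (\<Sum>j\<in>UNIV. (z - y) $ j * (w - y) $ j)"
      by (simp add: inner_vec_def)
    also have "\<dots> = (\<Sum>i = 1..m. (z - y) $ \<iota> i * (w - y) $ \<iota> i)"
      using sum.reindex_bij_betw[OF bij, of "\<lambda>j. (z - y) $ j * (w - y) $ j"] by simp
    also have "\<dots> = (z $ \<iota> 1 - t) * (w $ \<iota> 1 - t)
        + (\<Sum>i = 2..m. (z - y) $ \<iota> i * (w - y) $ \<iota> i)"
      using m y1 by (simp add: sum.atLeast_Suc_atMost[of "Suc 0" m] numeral_2_eq_2)
    also have "\<dots> \<le> (z $ \<iota> 1 - t) * (w $ \<iota> 1 - t)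
        + (\<Sum>i = 2..m. min (z $ \<iota> i - \<alpha> i - t) 0 * (w $ \<iota> 1 - t))"
      by (intro add_left_mono sum_mono term_le)
    also have "\<dots> = ((z $ \<iota> 1 - t) + (\<Sum>i = 2..m. min (z $ \<iota> i - \<alpha> i - t) 0)) * (w $ \<iota> 1 - t)"
      by (simp only: distrib_right sum_distrib_right)
    also have "\<dots> = 0"
      by (simp only: stationary mult_zero_left)
    finally have obtuse: "(z - y) \<bullet> (w - y) \<le> 0" .
    have "(z - w) \<bullet> (z - w) = (z - y) \<bullet> (z - y) - 2 * ((z - y) \<bullet> (w - y)) + (w - y) \<bullet> (w - y)"
      by (simp add: inner_diff_left inner_diff_right inner_commute)
    then show ?thesis
      unfolding norm_le using obtuse inner_ge_zero[of "w - y"] by linarith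
  qed
  then have y_eq: "closest_point (lower_gap_set \<iota> m \<alpha>) z = y"
    using closest_point_lower_gap_set_iff[OF bij, of y \<alpha> z] y_mem by simp
  show "closest_point (lower_gap_set \<iota> m \<alpha>) z $ \<iota> 1 = t"
    by (simp only: y_eq y1)
  show "closest_point (lower_gap_set \<iota> m \<alpha>) z $ \<iota> i = max t (z $ \<iota> i - \<alpha> i) + \<alpha> i"
    if "i \<in> {2..m}"
    by (simp only: y_eq yi[OF that])
qed

text \<open>
  The mean of the first \<open>k\<close> entries solves the stationarity equation of the sorted data. The entry
  \<open>\<delta> 1\<close> is exempt from the sorting and, unlike the others, enters the equation without truncation.
\<close>

lemma sum_min_mean_eq_0:
  fixes \<delta> :: "nat \<Rightarrow> real"
  assumes m: "m \<ge> 1"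
    and mono: "mono_on {2..m} \<delta>"
    and k_def: "k = Max {j \<in> {1..m}. \<delta> j \<le> (\<Sum>i = 1..j. \<delta> i) / real j}"
    and t_def: "t = (\<Sum>i = 1..k. \<delta> i) / real k"
  shows "(\<delta> 1 - t) + (\<Sum>i = 2..m. min (\<delta> i - t) 0) = 0"
proof -
  let ?J = "{j \<in> {1..m}. \<delta> j \<le> (\<Sum>i = 1..j. \<delta> i) / real j}"
  have fin: "finite ?J"
    by simp
  have "1 \<in> ?J"
    using m by simp
  then have "k \<in> ?J"
    unfolding k_def using fin by (intro Max_in) auto
  then have k: "1 \<le> k" "k \<le> m" "\<delta> k \<le> t"
    by (auto simp: t_def)
  have sum_k: "(\<Sum>i = 1..k. \<delta> i) = real k * t"
    using k by (simp add: t_def)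
  have below: "\<delta> i \<le> t" if "i \<in> {2..k}" for i
    using mono_onD[OF mono, of i k] that k by auto
  have above: "t \<le> \<delta> i" if i: "i \<in> {Suc k..m}" for i
  proof -
    have "Suc k \<notin> ?J"
      using Max_ge[OF fin, of "Suc k", folded k_def] by (auto simp del: mem_Collect_eq)
    \<comment> \<open>By maximality of \<open>k\<close>, the entry \<open>\<delta> (Suc k)\<close> exceeds the mean that includes it, and hence
      also the mean \<open>t\<close> of the entries before it.\<close>
    then have "\<not> \<delta> (Suc k) \<le> (\<Sum>i = 1..Suc k. \<delta> i) / real (Suc k)"
      using i by auto
    then have "(real k * t + \<delta> (Suc k)) / real (Suc k) < \<delta> (Suc k)"
      using sum_k by simp
    then have "real k * t < real k * \<delta> (Suc k)"
      by (simp add: divide_less_eq algebra_simps)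
    then have "t < \<delta> (Suc k)"
      using k by simp
    also have "\<delta> (Suc k) \<le> \<delta> i"
      using mono_onD[OF mono, of "Suc k" i] i k by auto
    finally show ?thesis
      by simp
  qed
  have "(\<Sum>i = 2..m. min (\<delta> i - t) 0) = (\<Sum>i = 2..k. \<delta> i - t)"
  proof (rule sum.mono_neutral_cong_right)
    show "\<forall>i\<in>{2..m} - {2..k}. min (\<delta> i - t) 0 = 0"
      using above by auto
  qed (use k below in auto)
  then have "(\<delta> 1 - t) + (\<Sum>i = 2..m. min (\<delta> i - t) 0) = (\<Sum>i = 1..k. \<delta> i - t)"
    using k by (simp add: sum.atLeast_Suc_atMost[of "Suc 0" k] numeral_2_eq_2)
  also have "\<dots> = 0"
    using sum_k by (simp add: sum_subtractf)
  finally show ?thesis .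
qed

theorem theorem3p3:
  fixes \<iota> :: "nat \<Rightarrow> 'n::finite" and m k :: nat and \<alpha> \<delta> :: "nat \<Rightarrow> real"
    and z x :: "real ^ 'n"
  assumes "m \<ge> 2"
    and "bij_betw \<iota> {1..m} (UNIV :: 'n set)"
    and "\<delta> 1 = z $ \<iota> 1"
    and "mono_on {2..m} \<delta>"
    and "image_mset \<delta> (mset_set {2..m}) = image_mset (\<lambda>i. z $ \<iota> i - \<alpha> i) (mset_set {2..m})"
    and "k = Max {j \<in> {1..m}. \<delta> j \<le> (\<Sum>i = 1..j. \<delta> i) / real j}"
    and "x = closest_point (lower_gap_set \<iota> m \<alpha>) z"
  shows "x $ \<iota> 1 = (\<Sum>i = 1..k. \<delta> i) / real k \<and>
    (\<forall>i\<in>{2..m}. x $ \<iota> i = max (x $ \<iota> 1) (z $ \<iota> i - \<alpha> i) + \<alpha> i)"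
proof -
  define t where "t = (\<Sum>i = 1..k. \<delta> i) / real k"
  have m: "m \<ge> 1"
    using assms(1) by simp
  let ?f = "\<lambda>s. min (s - t) 0"
  have "(\<Sum>i = 2..m. ?f (z $ \<iota> i - \<alpha> i))
      = sum_mset (image_mset ?f (image_mset (\<lambda>i. z $ \<iota> i - \<alpha> i) (mset_set {2..m})))"
    by (simp add: sum_unfold_sum_mset multiset.map_comp comp_def)
  also have "\<dots> = sum_mset (image_mset ?f (image_mset \<delta> (mset_set {2..m})))"
    by (simp only: assms(5))
  also have "\<dots> = (\<Sum>i = 2..m. ?f (\<delta> i))"
    by (simp add: sum_unfold_sum_mset multiset.map_comp comp_def)
  finally have "(z $ \<iota> 1 - t) + (\<Sum>i = 2..m. ?f (z $ \<iota> i - \<alpha> i)) = 0"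
    using sum_min_mean_eq_0[OF m assms(4,6) t_def] assms(3) by simp
  note coords = closest_point_lower_gap_set_coords[OF m assms(2) this, folded assms(7)]
  show ?thesis
    using coords by (simp add: t_def)
qed

end
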